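(* Let $1\le b\le n$ be integers and $k=\lceil n/b\rceil$. For any factorization $\mathbf{A}=\mathbf{B}\mathbf{C}$ with $\mathbf{B},\mathbf{C}\in\mathbb{R}^{n\times n}$, the error at step $n$ under $b$-min-separation satisfies $$\mathcal{E}_n(\mathbf{B},\mathbf{C})=\Omega\left(\frac{k}{n}+\frac{1}{\sqrt n}\right).$$ If moreover $\mathbf{C}$ is lower triangular and either (a) Toeplitz with positive coefficients, or (b) Toeplitz and $b$-banded, or (c) column-normalized and $b$-banded, then $$\mathcal{E}_n(\mathbf{B},\mathbf{C})=\Omega\left(\sqrt{\frac{k}{n}}\right).$$ The implied constants are absolute.
   Context: $\mathbf{A}\in\mathbb{R}^{n\times n}$ is the running-average matrix: $\mathbf{A}_{i,j}=1/i$ for $j\le i$ and $0$ for $j>i$. Sensitivity: $\Pi_{k,b}$ is the family of subsets $\pi\subseteq\{1,\dots,n\}$ with $|\pi|\le k$ such that any two distinct $i,j\in\pi$ satisfy $|i-j|\ge b$. For a fixed dimension $d\ge1$, $$\mathrm{sens}_{k,b}(\mathbf{C})=\max_{\pi\in\Pi_{k,b}}\ \max_{(x_i)_{i\in\pi},\ x_i\in\mathbb{R}^d,\ \|x_i\|_2\le1}\Big\|\sum_{i\in\pi}\mathbf{C}_{:,i}\,x_i^\top\Big\|_F ,$$ where $\mathbf{C}_{:,i}$ is the $i$-th column. The error at step $n$ is $\mathcal{E}_n(\mathbf{B},\mathbf{C})=\frac{1}{\sqrt n}\|\mathbf{B}\|_F\cdot\mathrm{sens}_{k,b}(\mathbf{C})$.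 A lower-triangular Toeplitz matrix has entries $c_{i-j}$ for $j\le i$ and $0$ for $j>i$; its coefficients are $c_0,\dots,c_{n-1}$. A lower-triangular matrix is $b$-banded if its $(i,j)$ entry vanishes whenever $i-j\ge b$. Column-normalized means that every column has Euclidean norm $1$. *)

theory Defs
  imports "Jordan_Normal_Form.Matrix" "HOL-Analysis.L2_Norm"
begin

text \<open>
  Matrices of arbitrary size are those of \<^theory>\<open>Jordan_Normal_Form.Matrix\<close>, whose rows and
  columns are numbered from 0. Row and column \<open>i\<close> here are therefore row and column \<open>i + 1\<close>
  in the usual numbering from 1.
\<close>

definition vec_norm2 :: "real vec \<Rightarrow> real" where
  "vec_norm2 v = L2_set (\<lambda>i. v $ i) {..<dim_vec v}"

definition frob_norm :: "real mat \<Rightarrow> real" where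
  "frob_norm M = L2_set (\<lambda>ij. M $$ ij) ({..<dim_row M} \<times> {..<dim_col M})"

definition running_average_mat :: "nat \<Rightarrow> real mat" where
  "running_average_mat n = mat n n (\<lambda>(i, j). if j \<le> i then 1 / real (i + 1) else 0)"

definition min_sep_sets :: "nat \<Rightarrow> nat \<Rightarrow> nat \<Rightarrow> nat set set" where
  "min_sep_sets n k b =
     {\<pi>. \<pi> \<subseteq> {..<n} \<and> card \<pi> \<le> k \<and>
         (\<forall>i\<in>\<pi>. \<forall>j\<in>\<pi>. i \<noteq> j \<longrightarrow> int b \<le> \<bar>int i - int j\<bar>)}"

text \<open>The matrix \<open>\<Sum>\<^sub>i\<^sub>\<in>\<^sub>\<pi> C\<^sub>:\<^sub>,\<^sub>i x\<^sub>i\<^sup>T\<close>, written entrywise.\<close>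

definition contrib_mat :: "nat \<Rightarrow> nat set \<Rightarrow> real mat \<Rightarrow> (nat \<Rightarrow> real vec) \<Rightarrow> real mat" where
  "contrib_mat d \<pi> C x = mat (dim_row C) d (\<lambda>(r, s). \<Sum>i\<in>\<pi>. col C i $ r * x i $ s)"

text \<open>Vectors outside \<open>\<pi>\<close> are unconstrained, but they do not enter \<^const>\<open>contrib_mat\<close>.\<close>

definition unit_inputs :: "nat \<Rightarrow> nat set \<Rightarrow> (nat \<Rightarrow> real vec) set" where
  "unit_inputs d \<pi> = {x. \<forall>i\<in>\<pi>. x i \<in> carrier_vec d \<and> vec_norm2 (x i) \<le> 1}"

text \<open>
  The inner maximum ranges over a product of closed unit balls; it is written as a supremum,
  which is taken over a nonempty bounded set of reals (see below).
\<close>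

definition sens :: "nat \<Rightarrow> nat \<Rightarrow> nat \<Rightarrow> real mat \<Rightarrow> real" where
  "sens d k b C =
     (MAX \<pi> \<in> min_sep_sets (dim_col C) k b. SUP x \<in> unit_inputs d \<pi>. frob_norm (contrib_mat d \<pi> C x))"

definition factorization_error ::
    "nat \<Rightarrow> nat \<Rightarrow> nat \<Rightarrow> nat \<Rightarrow> real mat \<Rightarrow> real mat \<Rightarrow> real" where
  "factorization_error n d k b B C = 1 / sqrt (real n) * frob_norm B * sens d k b C"

definition lower_triangular :: "real mat \<Rightarrow> bool" where
  "lower_triangular M \<longleftrightarrow> (\<forall>i<dim_row M. \<forall>j<dim_col M. i < j \<longrightarrow> M $$ (i, j) = 0)"

definition lower_toeplitz_with :: "(nat \<Rightarrow> real) \<Rightarrow> real mat \<Rightarrow> bool" where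
  "lower_toeplitz_with c M \<longleftrightarrow>
     (\<forall>i<dim_row M. \<forall>j<dim_col M. M $$ (i, j) = (if j \<le> i then c (i - j) else 0))"

definition lower_toeplitz :: "real mat \<Rightarrow> bool" where
  "lower_toeplitz M \<longleftrightarrow> (\<exists>c. lower_toeplitz_with c M)"

definition positive_lower_toeplitz :: "real mat \<Rightarrow> bool" where
  "positive_lower_toeplitz M \<longleftrightarrow>
     (\<exists>c. lower_toeplitz_with c M \<and> (\<forall>m<dim_row M. 0 < c m))"

text \<open>Stated without subtraction: \<open>j + b \<le> i\<close> is \<open>i - j \<ge> b\<close> over the integers.\<close>

definition banded :: "nat \<Rightarrow> real mat \<Rightarrow> bool" where
  "banded b M \<longleftrightarrow> (\<forall>i<dim_row M. \<forall>j<dim_col M. j + b \<le> i \<longrightarrow> M $$ (i, j) = 0)"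

definition column_normalized :: "real mat \<Rightarrow> bool" where
  "column_normalized M \<longleftrightarrow> (\<forall>j<dim_col M. vec_norm2 (col M j) = 1)"

lemma finite_min_sep_sets: "finite (min_sep_sets n k b)"
  by (rule finite_subset[of _ "Pow {..<n}"]) (auto simp: min_sep_sets_def)

lemma min_sep_sets_nonempty: "min_sep_sets n k b \<noteq> {}"
  by (auto simp: min_sep_sets_def intro: exI[of _ "{}"])

lemma unit_inputs_nonempty: "unit_inputs d \<pi> \<noteq> {}"
proof -
  have "(\<lambda>_. 0\<^sub>v d) \<in> unit_inputs d \<pi>"
    by (simp add: unit_inputs_def vec_norm2_def L2_set_def)
  then show ?thesis by blast
qed

lemma bdd_above_contrib:
  "bdd_above ((\<lambda>x. frob_norm (contrib_mat d \<pi> C x)) ` unit_inputs d \<pi>)"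
proof (rule bdd_aboveI2)
  fix x assume x: "x \<in> unit_inputs d \<pi>"
  have entry: "\<bar>x i $ s\<bar> \<le> 1" if "i \<in> \<pi>" "s < d" for i s
  proof -
    from x that have dim: "dim_vec (x i) = d" and n: "vec_norm2 (x i) \<le> 1"
      by (auto simp: unit_inputs_def)
    have "\<bar>x i $ s\<bar> = L2_set (\<lambda>s. x i $ s) {s}" by simp
    also have "\<dots> \<le> L2_set (\<lambda>s. x i $ s) {..<d}"
      unfolding L2_set_def using that by (intro real_sqrt_le_mono sum_mono2) auto
    finally show ?thesis using n dim by (simp add: vec_norm2_def)
  qed
  let ?I = "{..<dim_row C} \<times> {..<d}"
  have "frob_norm (contrib_mat d \<pi> C x) \<le> (\<Sum>rs\<in>?I. \<bar>contrib_mat d \<pi> C x $$ rs\<bar>)"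
    unfolding frob_norm_def by (rule order_trans[OF L2_set_le_sum_abs]) (simp add: contrib_mat_def)
  also have "\<dots> \<le> (\<Sum>rs\<in>?I. \<Sum>i\<in>\<pi>. \<bar>col C i $ fst rs\<bar>)"
  proof (rule sum_mono)
    fix rs assume "rs \<in> ?I"
    then obtain r s where rs: "rs = (r, s)" "r < dim_row C" "s < d" by auto
    have "\<bar>\<Sum>i\<in>\<pi>. col C i $ r * x i $ s\<bar> \<le> (\<Sum>i\<in>\<pi>. \<bar>col C i $ r * x i $ s\<bar>)"
      by (rule sum_abs)
    also have "\<dots> \<le> (\<Sum>i\<in>\<pi>. \<bar>col C i $ r\<bar>)"
      using entry rs by (intro sum_mono) (auto simp: abs_mult intro!: mult_left_le)
    finally show "\<bar>contrib_mat d \<pi> C x $$ rs\<bar> \<le> (\<Sum>i\<in>\<pi>. \<bar>col C i $ fst rs\<bar>)"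
      using rs by (simp add: contrib_mat_def)
  qed
  finally show "frob_norm (contrib_mat d \<pi> C x) \<le> (\<Sum>rs\<in>?I. \<Sum>i\<in>\<pi>. \<bar>col C i $ fst rs\<bar>)" .
qed

end

theory Submission
  imports Defs
begin

text \<open>
  Feeding one and the same unit vector at every step of the grid \<open>\<pi> = {0, b, 2b, \<dots>}\<close> shows that
  the sensitivity is at least the norm of \<open>C v\<close>, where \<open>v\<close> is the indicator of \<open>\<pi>\<close>. By
  Cauchy--Schwarz \<open>\<parallel>A v\<parallel> \<le> \<parallel>B\<parallel>\<^sub>F \<parallel>C v\<parallel>\<close>; every entry of \<open>A v\<close> is at least \<open>1/b\<close>, which gives the
  term \<open>k/n\<close>, and \<open>\<pi> = {0}\<close> gives the term \<open>1/\<surd>n\<close>.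

  In the three structured cases distinct columns of \<open>C\<close> on the grid have entrywise nonnegative
  products, so \<open>\<parallel>C v\<parallel>\<^sup>2\<close> is at least the sum of the \<open>k\<close> squared column norms. If \<open>C\<close> is
  column-normalized, these are \<open>1\<close>, and \<open>\<parallel>B\<parallel>\<^sub>F \<ge> 1\<close> because the first column of \<open>A\<close> has norm at
  least \<open>1\<close>. If \<open>C\<close> is Toeplitz, they are at least \<open>c\<^sub>0\<^sup>2\<close>, and \<open>\<parallel>B\<parallel>\<^sub>F \<ge> 1/\<bar>c\<^sub>0\<bar>\<close>: as \<open>c\<^sub>0 \<noteq> 0\<close>,
  the first row of \<open>B\<close> vanishes off the diagonal, whence \<open>B\<^sub>0\<^sub>0 c\<^sub>0 = A\<^sub>0\<^sub>0 = 1\<close>.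
\<close>

section \<open>Sensitivity against the norm of \<open>C v\<close>, with \<open>v\<close> the
  indicator vector of \<open>\<pi>\<close>\<close>

definition column_sum_norm :: "nat set \<Rightarrow> real mat \<Rightarrow> real" where
  "column_sum_norm \<pi> M = L2_set (\<lambda>r. \<Sum>i\<in>\<pi>. M $$ (r, i)) {..<dim_row M}"

lemma column_sum_norm_le_sens:
  assumes d: "1 \<le> d" and \<pi>: "\<pi> \<in> min_sep_sets (dim_col C) k b"
  shows "column_sum_norm \<pi> C \<le> sens d k b C"
proof -
  let ?x = "\<lambda>_::nat. unit_vec d 0 :: real vec"
  have sub: "\<pi> \<subseteq> {..<dim_col C}" using \<pi> by (auto simp: min_sep_sets_def)
  have "vec_norm2 (unit_vec d 0) = 1"
  proof -
    have "(\<Sum>i<d. (unit_vec d 0 $ i :: real)\<^sup>2) = (\<Sum>i<d. if i = 0 then 1 else 0)"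
      by (intro sum.cong) auto
    then show ?thesis using d by (simp add: vec_norm2_def L2_set_def)
  qed
  then have x: "?x \<in> unit_inputs d \<pi>" by (simp add: unit_inputs_def)
  \<comment> \<open>With the first unit vector as the common input, only column 0 of the
    contribution matrix survives, and it equals \<open>C v\<close>.\<close>
  have "(\<Sum>ij\<in>{..<dim_row C} \<times> {..<d}. (contrib_mat d \<pi> C ?x $$ ij)\<^sup>2)
      = (\<Sum>r<dim_row C. \<Sum>s<d. if s = 0 then (\<Sum>i\<in>\<pi>. C $$ (r, i))\<^sup>2 else 0)"
    unfolding sum.cartesian_product
  proof (intro sum.cong refl, clarify)
    fix r s assume rs: "r < dim_row C" "s < d"
    have "contrib_mat d \<pi> C ?x $$ (r, s) = (\<Sum>i\<in>\<pi>. if s = 0 then C $$ (r, i) else 0)"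
      using rs sub by (auto simp: contrib_mat_def subset_iff intro!: sum.cong)
    then show "(contrib_mat d \<pi> C ?x $$ (r, s))\<^sup>2 = (if s = 0 then (\<Sum>i\<in>\<pi>. C $$ (r, i))\<^sup>2 else 0)"
      by simp
  qed
  also have "\<dots> = (\<Sum>r<dim_row C. (\<Sum>i\<in>\<pi>. C $$ (r, i))\<^sup>2)"
    using d by (intro sum.cong) auto
  finally have "column_sum_norm \<pi> C = frob_norm (contrib_mat d \<pi> C ?x)"
    by (simp add: column_sum_norm_def frob_norm_def L2_set_def contrib_mat_def)
  also have "\<dots> \<le> (SUP x \<in> unit_inputs d \<pi>. frob_norm (contrib_mat d \<pi> C x))"
    by (rule cSUP_upper[OF x bdd_above_contrib])
  also have "\<dots> \<le> sens d k b C"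
    unfolding sens_def using \<pi> by (intro Max_ge finite_imageI finite_min_sep_sets imageI)
  finally show ?thesis .
qed

section \<open>Norm inequalities for products and for sums of columns\<close>

lemma frob_norm_nonneg: "0 \<le> frob_norm M"
  by (simp add: frob_norm_def)

lemma abs_entry_le_frob_norm:
  assumes "i < dim_row M" "j < dim_col M"
  shows "\<bar>M $$ (i, j)\<bar> \<le> frob_norm M"
proof -
  have "\<bar>M $$ (i, j)\<bar> = L2_set (\<lambda>ij. M $$ ij) {(i, j)}" by simp
  also have "\<dots> \<le> frob_norm M"
    unfolding frob_norm_def L2_set_def using assms by (intro real_sqrt_le_mono sum_mono2) auto
  finally show ?thesis .
qed

text \<open>Entry \<open>r\<close> of \<open>B C v\<close> is the inner product of row
  \<open>r\<close> of \<open>B\<close> with \<open>C v\<close>. Cauchy-Schwarz applies in each row,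
  and the norms of the rows combine to the Frobenius norm.\<close>

lemma column_sum_norm_mult_le:
  assumes B: "B \<in> carrier_mat m l" and C: "C \<in> carrier_mat l n" and \<pi>: "\<pi> \<subseteq> {..<n}"
  shows "column_sum_norm \<pi> (B * C) \<le> frob_norm B * column_sum_norm \<pi> C"
proof -
  let ?w = "\<lambda>s. \<Sum>i\<in>\<pi>. C $$ (s, i)"
  let ?W = "L2_set ?w {..<l}"
  have entry: "(\<Sum>i\<in>\<pi>. (B * C) $$ (r, i)) = (\<Sum>s<l. B $$ (r, s) * ?w s)" if "r < m" for r
  proof -
    have "(\<Sum>i\<in>\<pi>. (B * C) $$ (r, i)) = (\<Sum>i\<in>\<pi>. \<Sum>s<l. B $$ (r, s) * C $$ (s, i))"
      using B C \<pi> that by (intro sum.cong) (auto simp: scalar_prod_def atLeast0LessThan)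
    also have "\<dots> = (\<Sum>s<l. B $$ (r, s) * ?w s)"
      by (subst sum.swap) (simp add: sum_distrib_left)
    finally show ?thesis .
  qed
  have "\<bar>\<Sum>i\<in>\<pi>. (B * C) $$ (r, i)\<bar> \<le> ?W * L2_set (\<lambda>s. B $$ (r, s)) {..<l}" if "r < m" for r
  proof -
    have "\<bar>\<Sum>i\<in>\<pi>. (B * C) $$ (r, i)\<bar> \<le> (\<Sum>s<l. \<bar>B $$ (r, s)\<bar> * \<bar>?w s\<bar>)"
      unfolding entry[OF that] by (rule order_trans[OF sum_abs]) (simp add: abs_mult)
    also have "\<dots> \<le> ?W * L2_set (\<lambda>s. B $$ (r, s)) {..<l}"
      by (subst mult.commute) (rule L2_set_mult_ineq)
    finally show ?thesis .
  qed
  then have "L2_set (\<lambda>r. \<bar>\<Sum>i\<in>\<pi>. (B * C) $$ (r, i)\<bar>) {..<m}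
      \<le> L2_set (\<lambda>r. ?W * L2_set (\<lambda>s. B $$ (r, s)) {..<l}) {..<m}"
    by (intro L2_set_mono) auto
  also have "\<dots> = ?W * L2_set (\<lambda>r. L2_set (\<lambda>s. B $$ (r, s)) {..<l}) {..<m}"
    by (simp add: L2_set_right_distrib)
  also have "L2_set (\<lambda>r. L2_set (\<lambda>s. B $$ (r, s)) {..<l}) {..<m} = frob_norm B"
    using B by (simp add: frob_norm_def L2_set_def sum_nonneg sum.cartesian_product case_prod_eta)
  finally show ?thesis
    using B C by (simp add: column_sum_norm_def L2_set_def mult.commute)
qed

lemma sum_squares_le_square_sum:
  fixes f :: "'a \<Rightarrow> real"
  assumes "finite A" and "\<And>i j. i \<in> A \<Longrightarrow> j \<in> A \<Longrightarrow> i \<noteq> j \<Longrightarrow> 0 \<le> f i * f j"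
  shows "(\<Sum>i\<in>A. (f i)\<^sup>2) \<le> (\<Sum>i\<in>A. f i)\<^sup>2"
proof -
  have "(f i)\<^sup>2 \<le> (\<Sum>j\<in>A. f i * f j)" if "i \<in> A" for i
  proof -
    have "0 \<le> (\<Sum>j\<in>A - {i}. f i * f j)" using assms(2) that by (intro sum_nonneg) auto
    then show ?thesis
      using that assms(1) by (simp add: sum.remove[of A i "\<lambda>j. f i * f j"] power2_eq_square)
  qed
  then have "(\<Sum>i\<in>A. (f i)\<^sup>2) \<le> (\<Sum>i\<in>A. \<Sum>j\<in>A. f i * f j)" by (rule sum_mono)
  then show ?thesis by (simp add: power2_eq_square sum_product)
qed

text \<open>The squared column norms are summed row by row; within a row, the cross terms of the
  squared sum are nonnegative. The bound \<open>m\<close> is a parameter so as to cover both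
  \<open>\<bar>c 0\<bar>\<close> and \<open>1\<close>.\<close>

lemma column_sum_norm_ge:
  assumes \<pi>: "\<pi> \<subseteq> {..<dim_col C}"
    and sgn: "\<And>r i j. r < dim_row C \<Longrightarrow> i \<in> \<pi> \<Longrightarrow> j \<in> \<pi> \<Longrightarrow> i \<noteq> j \<Longrightarrow> 0 \<le> C $$ (r, i) * C $$ (r, j)"
    and m: "0 \<le> m" "\<And>i. i \<in> \<pi> \<Longrightarrow> m \<le> vec_norm2 (col C i)"
  shows "sqrt (card \<pi>) * m \<le> column_sum_norm \<pi> C"
proof -
  have fin: "finite \<pi>" using \<pi> finite_subset by blast
  have "card \<pi> * m\<^sup>2 = (\<Sum>i\<in>\<pi>. m\<^sup>2)" by simp
  also have "\<dots> \<le> (\<Sum>i\<in>\<pi>. (vec_norm2 (col C i))\<^sup>2)"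
    using m by (intro sum_mono power_mono) auto
  also have "\<dots> = (\<Sum>i\<in>\<pi>. \<Sum>r<dim_row C. (C $$ (r, i))\<^sup>2)"
    using \<pi> by (intro sum.cong) (auto simp: vec_norm2_def L2_set_def sum_nonneg)
  also have "\<dots> = (\<Sum>r<dim_row C. \<Sum>i\<in>\<pi>. (C $$ (r, i))\<^sup>2)" by (rule sum.swap)
  also have "\<dots> \<le> (\<Sum>r<dim_row C. (\<Sum>i\<in>\<pi>. C $$ (r, i))\<^sup>2)"
    using sgn fin by (intro sum_mono sum_squares_le_square_sum) auto
  finally have "sqrt (card \<pi> * m\<^sup>2) \<le> column_sum_norm \<pi> C"
    unfolding column_sum_norm_def L2_set_def by (rule real_sqrt_le_mono)
  then show ?thesis using m(1) by (simp add: real_sqrt_mult)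
qed

section \<open>The grid of multiples of \<open>b\<close>\<close>

definition grid :: "nat \<Rightarrow> nat \<Rightarrow> nat set" where
  "grid k b = (\<lambda>j. j * b) ` {..<k}"

lemma card_grid: "1 \<le> b \<Longrightarrow> card (grid k b) = k"
  by (simp add: grid_def card_image inj_on_def)

lemma grid_separated:
  assumes "i \<in> grid k b" "j \<in> grid k b" "i < j"
  shows "i + b \<le> j"
proof -
  obtain u v where uv: "i = u * b" "j = v * b" using assms by (auto simp: grid_def)
  then have "u + 1 \<le> v" using assms(3) by (simp add: Suc_le_eq)
  then have "(u + 1) * b \<le> v * b" by (rule mult_le_mono1)
  then show ?thesis using uv by simp
qed

text \<open>The ceiling enters later only through these inequalities: by the first, the grid
  contains every multiple of \<open>b\<close> below \<open>n\<close>; by the second, its last point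
  \<open>(k - 1) * b\<close> is a valid column.\<close>

lemma ceiling_div_bounds:
  assumes "1 \<le> b" "k = nat \<lceil>real n / real b\<rceil>"
  shows "n \<le> k * b" "k * b < n + b"
proof -
  have k: "real k = of_int \<lceil>real n / real b\<rceil>" using assms(2) by simp
  have "real n / b \<le> k" "k < real n / b + 1" unfolding k by linarith+
  then have "real n \<le> real (k * b)" "real (k * b) < real (n + b)"
    using assms(1) by (simp_all add: field_simps)
  then show "n \<le> k * b" "k * b < n + b" by (simp_all only: of_nat_le_iff of_nat_less_iff)
qed

lemma grid_in_min_sep_sets:
  assumes "1 \<le> b" "k * b < n + b"
  shows "grid k b \<in> min_sep_sets n k b"
proof -
  have "j * b < n" if "j < k" for j
  proof -
    have "(j + 1) * b \<le> k * b" using that by (intro mult_le_mono1) simp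
    then show ?thesis using assms by simp
  qed
  moreover have "int b \<le> \<bar>int i - int j\<bar>" if "i \<in> grid k b" "j \<in> grid k b" "i \<noteq> j" for i j
    using grid_separated[of i k b j] grid_separated[of j k b i] that by linarith
  ultimately show ?thesis
    using card_grid[OF assms(1), of k] by (auto simp: min_sep_sets_def grid_def)
qed

section \<open>Column sums of the running-average matrix\<close>

lemma dim_running_average_mat [simp]:
  "dim_row (running_average_mat n) = n" "dim_col (running_average_mat n) = n"
  by (simp_all add: running_average_mat_def)

text \<open>Row \<open>r\<close> of \<open>A v\<close> is the number of grid points up to
  \<open>r\<close>, divided by \<open>r + 1\<close>. There are at least \<open>(r + 1) / b\<close>
  such points, so each of the \<open>n\<close> entries is at least \<open>1 / b\<close>.\<close>

lemma column_sum_norm_running_average_grid: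
  assumes b: "1 \<le> b" and k: "n \<le> k * b" "k * b < n + b"
  shows "sqrt n / b \<le> column_sum_norm (grid k b) (running_average_mat n)"
proof -
  have sub: "grid k b \<subseteq> {..<n}"
    using grid_in_min_sep_sets[OF b k(2)] by (auto simp: min_sep_sets_def)
  have fin: "finite (grid k b)" by (simp add: grid_def)
  have entry: "1 / b \<le> (\<Sum>i\<in>grid k b. running_average_mat n $$ (r, i))" if r: "r < n" for r
  proof -
    \<comment> \<open>The bound \<open>n \<le> k * b\<close> ensures that no multiple of
      \<open>b\<close> up to \<open>r\<close> is missing from the grid; counting 0, there are
      \<open>r div b + 1\<close> of them.\<close>
    have "r div b < k" using r k(1) b by (simp add: less_mult_imp_div_less)
    then have "(\<lambda>j. j * b) ` {..r div b} \<subseteq> grid k b \<inter> {..r}"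
      using div_times_less_eq_dividend[of r b]
      by (auto simp: grid_def intro: order_trans[OF mult_le_mono1])
    then have "card ((\<lambda>j. j * b) ` {..r div b}) \<le> card (grid k b \<inter> {..r})"
      using fin by (intro card_mono) auto
    moreover have "card ((\<lambda>j. j * b) ` {..r div b}) = r div b + 1"
      using b by (simp add: card_image inj_on_def)
    ultimately have "(r div b + 1) * b \<le> card (grid k b \<inter> {..r}) * b" by (intro mult_le_mono1) simp
    moreover have "r + 1 \<le> (r div b + 1) * b"
      using b dividend_less_div_times[of b r] by simp
    ultimately have "real (r + 1) \<le> real (card (grid k b \<inter> {..r}) * b)"
      by (simp only: of_nat_le_iff)
    then have "1 / b \<le> card (grid k b \<inter> {..r}) / (r + 1)"
      using b by (simp add: field_simps)
    also have "\<dots> = (\<Sum>i\<in>grid k b \<inter> {..r}. 1 / (r + 1))" by simp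
    also have "\<dots> = (\<Sum>i\<in>grid k b. if i \<in> {..r} then 1 / (r + 1) else 0)"
      by (rule sum.inter_restrict[OF fin])
    also have "\<dots> = (\<Sum>i\<in>grid k b. running_average_mat n $$ (r, i))"
      using sub r by (intro sum.cong) (auto simp: running_average_mat_def)
    finally show ?thesis .
  qed
  have "sqrt n / b = L2_set (\<lambda>_. 1 / b) {..<n}"
    using b by (simp add: L2_set_def real_sqrt_divide power_divide)
  also have "\<dots> \<le> column_sum_norm (grid k b) (running_average_mat n)"
    unfolding column_sum_norm_def using entry by (auto intro: L2_set_mono)
  finally show ?thesis .
qed

lemma column_sum_norm_running_average_0:
  assumes "1 \<le> n"
  shows "1 \<le> column_sum_norm {0} (running_average_mat n)"
proof -
  have "1 = running_average_mat n $$ (0, 0)" using assms by (simp add: running_average_mat_def)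
  also have "\<dots> \<le> column_sum_norm {0} (running_average_mat n)"
    using member_le_L2_set[of "{..<n}" 0 "\<lambda>r. running_average_mat n $$ (r, 0)"] assms
    by (simp add: column_sum_norm_def)
  finally show ?thesis .
qed

section \<open>The norm of \<open>B\<close> against the columns of \<open>C\<close>\<close>

lemma one_le_frob_norm_mult_column_norm:
  assumes n: "1 \<le> n" and B: "B \<in> carrier_mat n n" and C: "C \<in> carrier_mat n n"
    and A: "running_average_mat n = B * C"
  shows "1 \<le> frob_norm B * vec_norm2 (col C 0)"
proof -
  have "column_sum_norm {0} C = vec_norm2 (col C 0)"
    using C n by (auto simp: column_sum_norm_def vec_norm2_def intro!: L2_set_cong)
  then show ?thesis
    using column_sum_norm_running_average_0[OF n] column_sum_norm_mult_le[OF B C, of "{0}"] n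
    unfolding A by simp
qed

text \<open>The norm of the first column of \<open>C\<close> may far exceed
  \<open>\<bar>c 0\<bar>\<close>, so comparing first columns is too weak here. The first row of
  \<open>B C\<close> isolates \<open>c 0\<close> instead.\<close>

lemma one_le_frob_norm_mult_toeplitz_coeff:
  assumes n: "1 \<le> n" and B: "B \<in> carrier_mat n n" and C: "C \<in> carrier_mat n n"
    and A: "running_average_mat n = B * C" and c: "lower_toeplitz_with c C"
  shows "1 \<le> frob_norm B * \<bar>c 0\<bar>"
proof -
  have Cij: "C $$ (i, j) = (if j \<le> i then c (i - j) else 0)" if "i < n" "j < n" for i j
    using c C that by (auto simp: lower_toeplitz_with_def)
  have prod: "running_average_mat n $$ (i, j) = (\<Sum>s<n. B $$ (i, s) * C $$ (s, j))"
    if "i < n" "j < n" for i j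
    unfolding A using B C that by (auto simp: scalar_prod_def atLeast0LessThan)
  \<comment> \<open>Otherwise the last column of \<open>C\<close> would vanish, while the last
    diagonal entry of \<open>A\<close> is \<open>1 / n\<close>.\<close>
  have c0: "c 0 \<noteq> 0"
  proof
    assume "c 0 = 0"
    then have "C $$ (s, n - 1) = 0" if "s < n" for s
      using that n by (auto simp: Cij dest: le_antisym)
    then have "running_average_mat n $$ (n - 1, n - 1) = 0" using n by (simp add: prod)
    then show False using n by (simp add: running_average_mat_def)
  qed
  \<comment> \<open>Back substitution from the last column: in entry \<open>(0, j)\<close> of
    \<open>B C\<close>, the terms with \<open>s < j\<close> vanish since \<open>C\<close> is lower
    triangular, those with \<open>j < s\<close> by induction. What remains is
    \<open>B $$ (0, j) * c 0 = 0\<close>.\<close>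
  have B0: "B $$ (0, j) = 0" if "j < n" "0 < j" for j
    using that
  proof (induction "n - j" arbitrary: j rule: less_induct)
    case less
    have "0 = running_average_mat n $$ (0, j)" using less.prems by (simp add: running_average_mat_def)
    also have "\<dots> = (\<Sum>s<n. B $$ (0, s) * C $$ (s, j))" using less.prems by (simp add: prod)
    also have "\<dots> = (\<Sum>s<n. if s = j then B $$ (0, j) * c 0 else 0)"
    proof (intro sum.cong refl)
      fix s assume s: "s \<in> {..<n}"
      have "B $$ (0, s) = 0" if "j < s" using that s less.prems by (intro less.hyps) auto
      then show "B $$ (0, s) * C $$ (s, j) = (if s = j then B $$ (0, j) * c 0 else 0)"
        using s less.prems by (auto simp: Cij)
    qed
    also have "\<dots> = B $$ (0, j) * c 0" using less.prems by simp
    finally show ?case using c0 by simp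
  qed
  have "1 = running_average_mat n $$ (0, 0)" using n by (simp add: running_average_mat_def)
  also have "\<dots> = (\<Sum>s<n. B $$ (0, s) * C $$ (s, 0))" using n by (simp add: prod)
  also have "\<dots> = (\<Sum>s<n. if s = 0 then B $$ (0, 0) * c 0 else 0)"
    using B0 by (intro sum.cong) (auto simp: Cij)
  also have "\<dots> = B $$ (0, 0) * c 0" using n by simp
  finally have "1 = \<bar>B $$ (0, 0)\<bar> * \<bar>c 0\<bar>" by (simp flip: abs_mult)
  also have "\<dots> \<le> frob_norm B * \<bar>c 0\<bar>"
    using B n by (intro mult_right_mono abs_entry_le_frob_norm) auto
  finally show ?thesis .
qed

text \<open>The diagonal entry of each column is \<open>c 0\<close>. In a square matrix the last
  column has no other nonzero entry, so no larger bound serves all columns.\<close>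

lemma toeplitz_coeff_le_column_norm:
  assumes "lower_toeplitz_with c C" "i < dim_row C" "i < dim_col C"
  shows "\<bar>c 0\<bar> \<le> vec_norm2 (col C i)"
proof -
  have "\<bar>c 0\<bar> = L2_set (\<lambda>r. col C i $ r) {i}"
    using assms by (simp add: lower_toeplitz_with_def)
  also have "\<dots> \<le> vec_norm2 (col C i)"
    unfolding vec_norm2_def L2_set_def using assms by (intro real_sqrt_le_mono sum_mono2) auto
  finally show ?thesis .
qed

text \<open>Column \<open>i\<close> is supported in rows \<open>i\<close> to
  \<open>i + b - 1\<close>, and column \<open>j\<close> starts only at row \<open>j\<close>, below
  that band.\<close>

lemma banded_columns_disjoint:
  assumes "lower_triangular C" "banded b C"
    and "r < dim_row C" "i < dim_col C" "j < dim_col C" "i + b \<le> j"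
  shows "C $$ (r, i) * C $$ (r, j) = 0"
  using assms by (cases "r < j") (auto simp: lower_triangular_def banded_def)

section \<open>Lower bounds on the error\<close>

lemma factorization_error_ge:
  assumes b: "1 \<le> b" "b \<le> n" and d: "1 \<le> d" and k: "k = nat \<lceil>real n / real b\<rceil>"
    and B: "B \<in> carrier_mat n n" and C: "C \<in> carrier_mat n n"
    and A: "running_average_mat n = B * C"
  shows "1 / 4 * (real k / real n + 1 / sqrt (real n)) \<le> factorization_error n d k b B C"
proof -
  note kb = ceiling_div_bounds[OF b(1) k]
  have n: "1 \<le> n" using b by simp
  have k1: "1 \<le> k" using kb(1) n by (cases k) auto
  \<comment> \<open>Every admissible \<open>\<pi>\<close> yields a bound free of \<open>B\<close>
    and \<open>C\<close>; it is applied to \<open>{0}\<close> and to the grid.\<close>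
  have *: "column_sum_norm \<pi> (running_average_mat n) / sqrt n \<le> factorization_error n d k b B C"
    if \<pi>: "\<pi> \<in> min_sep_sets n k b" for \<pi>
  proof -
    have "column_sum_norm \<pi> (running_average_mat n) \<le> frob_norm B * column_sum_norm \<pi> C"
      unfolding A using \<pi> by (intro column_sum_norm_mult_le[OF B C]) (auto simp: min_sep_sets_def)
    also have "\<dots> \<le> frob_norm B * sens d k b C"
      using \<pi> C by (intro mult_left_mono column_sum_norm_le_sens d frob_norm_nonneg) auto
    finally show ?thesis
      by (simp add: factorization_error_def divide_right_mono)
  qed
  have "1 / sqrt n \<le> column_sum_norm {0} (running_average_mat n) / sqrt n"
    by (intro divide_right_mono column_sum_norm_running_average_0 n) simp
  also have "\<dots> \<le> factorization_error n d k b B C"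
    using n k1 by (intro *) (simp add: min_sep_sets_def)
  finally have 1: "1 / sqrt n \<le> factorization_error n d k b B C" .
  \<comment> \<open>Rounding \<open>n / b\<close> up to \<open>k\<close> at most doubles it, since
    \<open>b \<le> n\<close>; hence \<open>1 / b\<close> is at least
    \<open>k / (2 * n)\<close>.\<close>
  have "k * b \<le> 2 * n" using kb(2) b by linarith
  then have "real (k * b) \<le> real (2 * n)" by (simp only: of_nat_le_iff)
  then have "k / (2 * real n) \<le> 1 / b" using b n by (simp add: field_simps)
  also have "1 / b = (sqrt n / b) / sqrt n" using n by simp
  also have "\<dots> \<le> column_sum_norm (grid k b) (running_average_mat n) / sqrt n"
    by (intro divide_right_mono column_sum_norm_running_average_grid b kb) simp
  also have "\<dots> \<le> factorization_error n d k b B C"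
    by (intro * grid_in_min_sep_sets b kb)
  finally have 2: "k / (2 * real n) \<le> factorization_error n d k b B C" .
  then have 2: "k / n \<le> 2 * factorization_error n d k b B C" by simp
  \<comment> \<open>The two bounds add up to three times the error. Passing to the factor 4 uses
    that the error is nonnegative, which follows from this and the first bound.\<close>
  have "0 \<le> 1 / sqrt n" by simp
  then have "k / n + 1 / sqrt n \<le> 4 * factorization_error n d k b B C" using 1 2 by linarith
  from mult_left_mono[OF this, of "1 / 4"] show ?thesis by (simp only: mult.assoc[symmetric]) simp
qed

lemma factorization_error_ge_structured:
  assumes b: "1 \<le> b" "b \<le> n" and d: "1 \<le> d" and k: "k = nat \<lceil>real n / real b\<rceil>"
    and B: "B \<in> carrier_mat n n" and C: "C \<in> carrier_mat n n"
    and A: "running_average_mat n = B * C" and lower: "lower_triangular C"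
    and struct: "positive_lower_toeplitz C \<or> (lower_toeplitz C \<and> banded b C) \<or>
      (column_normalized C \<and> banded b C)"
  shows "sqrt (real k / real n) \<le> factorization_error n d k b B C"
proof -
  note kb = ceiling_div_bounds[OF b(1) k]
  have n: "1 \<le> n" using b by simp
  have \<pi>: "grid k b \<in> min_sep_sets n k b" by (intro grid_in_min_sep_sets b kb)
  then have sub: "grid k b \<subseteq> {..<n}" by (simp add: min_sep_sets_def)
  \<comment> \<open>The three cases are split in two ways: by bandedness for the signs, and below by
    the Toeplitz property for the size of the columns.\<close>
  have sgn: "0 \<le> C $$ (r, i) * C $$ (r, j)"
    if "r < n" "i \<in> grid k b" "j \<in> grid k b" "i \<noteq> j" for r i j
  proof (cases "banded b C")
    case True
    have "i + b \<le> j \<or> j + b \<le> i"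
      using grid_separated[of i k b j] grid_separated[of j k b i] that by linarith
    moreover have "i < n" "j < n" using that sub by auto
    ultimately have "C $$ (r, i) * C $$ (r, j) = 0"
      using banded_columns_disjoint[OF lower True, of r i j]
        banded_columns_disjoint[OF lower True, of r j i] C that
      by auto
    then show ?thesis by (simp only: order_refl)
  \<comment> \<open>Only positive Toeplitz coefficients remain, so all entries of \<open>C\<close>
    are nonnegative.\<close>
  next
    case False
    then obtain c where "lower_toeplitz_with c C" "\<forall>m<n. 0 < c m"
      using struct C by (auto simp: positive_lower_toeplitz_def)
    then show ?thesis using C that sub
      by (auto simp: lower_toeplitz_with_def subset_iff intro!: mult_nonneg_nonneg less_imp_le)
  qed
  \<comment> \<open>The scale \<open>m\<close> bounds all column norms from below and cancels
    against \<open>B\<close>: it is \<open>\<bar>c 0\<bar>\<close> for Toeplitz \<open>C\<close> and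
    \<open>1\<close> for column-normalized \<open>C\<close>.\<close>
  obtain m where m: "0 \<le> m" "1 \<le> frob_norm B * m"
    and col: "\<And>i. i < n \<Longrightarrow> m \<le> vec_norm2 (col C i)"
  proof (cases "lower_toeplitz C")
    case True
    then obtain c where "lower_toeplitz_with c C" by (auto simp: lower_toeplitz_def)
    then show thesis
      using that[of "\<bar>c 0\<bar>"] one_le_frob_norm_mult_toeplitz_coeff[OF n B C A]
        toeplitz_coeff_le_column_norm[of c C] C by auto
  next
    case False
    then have "column_normalized C"
      using struct by (auto simp: positive_lower_toeplitz_def lower_toeplitz_def)
    then show thesis
      using that[of 1] one_le_frob_norm_mult_column_norm[OF n B C A] C n
      by (auto simp: column_normalized_def)
  qed
  have "sqrt k \<le> frob_norm B * m * sqrt k"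
    using m(2) by (simp add: mult_right_mono[of 1 "frob_norm B * m" "sqrt k", simplified])
  also have "\<dots> = frob_norm B * (sqrt (card (grid k b)) * m)"
    using b by (simp add: card_grid)
  also have "\<dots> \<le> frob_norm B * column_sum_norm (grid k b) C"
    using C sub sgn m(1) col by (intro mult_left_mono column_sum_norm_ge frob_norm_nonneg) auto
  also have "\<dots> \<le> frob_norm B * sens d k b C"
    using \<pi> C by (intro mult_left_mono column_sum_norm_le_sens d frob_norm_nonneg) auto
  finally show ?thesis
    by (simp add: factorization_error_def real_sqrt_divide divide_right_mono)
qed

theorem theorem3:
  shows
    "(\<exists>c > 0. \<forall>(n::nat) (b::nat) (d::nat) (k::nat) B C.
        1 \<le> b \<longrightarrow> b \<le> n \<longrightarrow> 1 \<le> d \<longrightarrow> k = nat \<lceil>real n / real b\<rceil> \<longrightarrow>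
        B \<in> carrier_mat n n \<longrightarrow> C \<in> carrier_mat n n \<longrightarrow> running_average_mat n = B * C \<longrightarrow>
        factorization_error n d k b B C \<ge> c * (real k / real n + 1 / sqrt (real n)))
     \<and>
     (\<exists>c > 0. \<forall>(n::nat) (b::nat) (d::nat) (k::nat) B C.
        1 \<le> b \<longrightarrow> b \<le> n \<longrightarrow> 1 \<le> d \<longrightarrow> k = nat \<lceil>real n / real b\<rceil> \<longrightarrow>
        B \<in> carrier_mat n n \<longrightarrow> C \<in> carrier_mat n n \<longrightarrow> running_average_mat n = B * C \<longrightarrow>
        lower_triangular C \<longrightarrow>
        positive_lower_toeplitz C \<or> (lower_toeplitz C \<and> banded b C) \<or>
          (column_normalized C \<and> banded b C) \<longrightarrow>
        factorization_error n d k b B C \<ge> c * sqrt (real k / real n))"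
proof (rule conjI; rule exI; intro conjI allI impI)
  \<comment> \<open>These goals instantiate the two constants left open by
    \<open>exI\<close>.\<close>
  show "0 < (1 / 4 :: real)" "0 < (1 :: real)" by simp_all
qed (use factorization_error_ge factorization_error_ge_structured in auto)

end
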